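(* Let $k,d\ge 0$ be integers. Let $M$ be a free FI-module generated in degree $\le k$, and let $V$ be an arbitrary FI-module generated in degree $\le d$. Then for any homomorphism of FI-modules $V\to M$, the kernel $\ker(V\to M)$ is generated in degree $\le k+d+1$.
   Context: $\mathrm{FI}$ is the category of finite sets and injections. An FI-module is a functor $W\colon \mathrm{FI}\to \mathbb{Z}\text{-Mod}$; write $W_T=W(T)$, $[n]=\{1,\dots,n\}$, $W_n=W_{[n]}$, and $f_*\colon W_S\to W_T$ for the map induced by an injection $f$. Degree: $\deg W=\inf\{k\in\{-\infty\}\cup\mathbb{N}\cup\{\infty\}\mid W_n=0\text{ for all }n\in\mathbb{N}\text{ with }n>k\}$. Define $H_0(W)_T=W_T/\operatorname{span}(\operatorname{im} f_*\colon W_S\to W_T\mid f\colon S\hookrightarrow T,\ |S|<|T|)$. An FI-module $W$ is generated in degree $\le m$ if $\deg H_0(W)\le m$. Free FI-modules: $\mathrm{FB}$ is the category of finite sets and bijections; an FB-module is a functor $\mathrm{FB}\to\mathbb{Z}\text{-Mod}$. For an FB-module $W$, the free FI-module $M(W)$ is $M(W)_T=\bigoplus_{S\subset T}W_S$, where an injection $f\colon T\hookrightarrow T'$ sends the summand $W_S$ to the summand $W_{f(S)}$ via the bijection $f|_S\colon S\to f(S)$ (so $M$ is left adjoint to the forgetful functor from FI-modules to FB-modules). A free FI-module is one of the form $M(W)$ for some FB-module $W$; it need not be projective. *)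

theory Defs
  imports "HOL-Algebra.Algebra" "HOL-Library.Extended_Real"
begin

text \<open>
  The category of finite sets and injections is represented by its full subcategory on the
  finite subsets of \<^typ>\<open>nat\<close>; it contains every \<open>[n]\<close>, so the inclusion is an equivalence.
  Morphisms are extensional functions, so that two morphisms \<open>S \<rightarrow> T\<close> are equal iff they agree
  on \<open>S\<close>. \<open>\<int>\<close>-modules are abelian groups, written multiplicatively as in \<^const>\<open>comm_group\<close>:
  the zero module is \<^const>\<open>trivial_group\<close>, the span is \<^const>\<open>generate\<close>, the direct sum is
  \<^const>\<open>sum_group\<close>.

  All \<open>W\<^sub>T\<close> share one carrier type \<open>'v\<close>. This is no restriction, since a family of groups indexed
  by the finite subsets of \<^typ>\<open>nat\<close> embeds into a disjoint union.
\<close>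

definition FI_hom :: "nat set \<Rightarrow> nat set \<Rightarrow> (nat \<Rightarrow> nat) set" where
  "FI_hom S T = {f \<in> S \<rightarrow>\<^sub>E T. inj_on f S}"

definition FB_hom :: "nat set \<Rightarrow> nat set \<Rightarrow> (nat \<Rightarrow> nat) set" where
  "FB_hom S T = {f \<in> S \<rightarrow>\<^sub>E T. bij_betw f S T}"

record 'v fin_functor =
  obj :: "nat set \<Rightarrow> 'v monoid"
  mor :: "nat set \<Rightarrow> nat set \<Rightarrow> (nat \<Rightarrow> nat) \<Rightarrow> 'v \<Rightarrow> 'v"

definition functor_to_Zmod ::
  "(nat set \<Rightarrow> nat set \<Rightarrow> (nat \<Rightarrow> nat) set) \<Rightarrow> 'v fin_functor \<Rightarrow> bool" where
  "functor_to_Zmod Hom W \<longleftrightarrow>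
     (\<forall>S. finite S \<longrightarrow> comm_group (obj W S)) \<and>
     (\<forall>S T. \<forall>f\<in>Hom S T. finite S \<longrightarrow> finite T \<longrightarrow> mor W S T f \<in> hom (obj W S) (obj W T)) \<and>
     (\<forall>S. finite S \<longrightarrow> (\<forall>v\<in>carrier (obj W S). mor W S S (\<lambda>x\<in>S. x) v = v)) \<and>
     (\<forall>S T U. \<forall>f\<in>Hom S T. \<forall>g\<in>Hom T U. finite S \<longrightarrow> finite T \<longrightarrow> finite U \<longrightarrow>
        (\<forall>v\<in>carrier (obj W S). mor W S U (compose S g f) v = mor W T U g (mor W S T f v)))"

definition FI_module :: "'v fin_functor \<Rightarrow> bool" where
  "FI_module W \<longleftrightarrow> functor_to_Zmod FI_hom W"

definition FB_module :: "'v fin_functor \<Rightarrow> bool" where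
  "FB_module W \<longleftrightarrow> functor_to_Zmod FB_hom W"

definition FI_module_hom ::
  "'v fin_functor \<Rightarrow> 'w fin_functor \<Rightarrow> (nat set \<Rightarrow> 'v \<Rightarrow> 'w) \<Rightarrow> bool" where
  "FI_module_hom V W \<phi> \<longleftrightarrow>
     (\<forall>S. finite S \<longrightarrow> \<phi> S \<in> hom (obj V S) (obj W S)) \<and>
     (\<forall>S T. \<forall>f\<in>FI_hom S T. finite S \<longrightarrow> finite T \<longrightarrow>
        (\<forall>v\<in>carrier (obj V S). \<phi> T (mor V S T f v) = mor W S T f (\<phi> S v)))"

definition FI_module_isomorphic :: "'v fin_functor \<Rightarrow> 'w fin_functor \<Rightarrow> bool" where
  "FI_module_isomorphic V W \<longleftrightarrow>
     (\<exists>\<phi>. FI_module_hom V W \<phi> \<and> (\<forall>S. finite S \<longrightarrow> \<phi> S \<in> iso (obj V S) (obj W S)))"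

definition FI_kernel ::
  "'v fin_functor \<Rightarrow> 'w fin_functor \<Rightarrow> (nat set \<Rightarrow> 'v \<Rightarrow> 'w) \<Rightarrow> 'v fin_functor" where
  "FI_kernel V W \<phi> =
     \<lparr>obj = (\<lambda>S. (obj V S)\<lparr>carrier := kernel (obj V S) (obj W S) (\<phi> S)\<rparr>), mor = mor V\<rparr>"

text \<open>
  The degree only depends on the underlying groups, so it is defined for a family of groups.
  The set below always has a least element, so taking the infimum in \<^typ>\<open>ereal\<close> is harmless.
\<close>

definition degree_FI :: "(nat set \<Rightarrow> 'v monoid) \<Rightarrow> ereal" where
  "degree_FI G =
     Inf {k \<in> {-\<infinity>} \<union> range (\<lambda>n::nat. ereal (real n)) \<union> {\<infinity>}.
           \<forall>n::nat. ereal (real n) > k \<longrightarrow> trivial_group (G {1..n})}"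

definition H0 :: "'v fin_functor \<Rightarrow> nat set \<Rightarrow> 'v set monoid" where
  "H0 W T = obj W T Mod
     generate (obj W T)
       (\<Union>{mor W S T f ` carrier (obj W S) | S f. finite S \<and> card S < card T \<and> f \<in> FI_hom S T})"

definition generated_in_degree_le :: "'v fin_functor \<Rightarrow> nat \<Rightarrow> bool" where
  "generated_in_degree_le W m \<longleftrightarrow> degree_FI (H0 W) \<le> ereal (real m)"

text \<open>
  An element of \<open>\<Oplus>\<^bsub>S \<subseteq> T\<^esub> W\<^sub>S\<close> is a family \<open>x\<close> with \<open>x S \<in> W\<^sub>S\<close>. As \<open>f\<close> is injective on \<open>T\<close>, the
  summands of the target that are hit are those at \<open>S' \<subseteq> f ` T\<close>, and \<open>S'\<close> is hit by the summand
  at the preimage of \<open>S'\<close> only.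
\<close>

definition M_free :: "'v fin_functor \<Rightarrow> (nat set \<Rightarrow> 'v) fin_functor" where
  "M_free W =
     \<lparr>obj = (\<lambda>T. sum_group (Pow T) (obj W)),
      mor = (\<lambda>T T' f x. \<lambda>S'\<in>Pow T'.
        if S' \<subseteq> f ` T
        then (let S = f -` S' \<inter> T in mor W S S' (restrict f S) (x S))
        else \<one>\<^bsub>obj W S'\<^esub>)\<rparr>"

text \<open>
  Freeness is invariant under isomorphism. The FB-module may be taken with the same carrier type
  as \<open>M\<close>, since each \<open>W\<^sub>S\<close> embeds into \<open>M(W)\<^sub>S\<close> as the summand at \<open>S\<close>.
\<close>

definition free_FI_module :: "'v fin_functor \<Rightarrow> bool" where
  "free_FI_module M \<longleftrightarrow>
     FI_module M \<and>
     (\<exists>W :: 'v fin_functor. FB_module W \<and> FI_module_isomorphic M (M_free W))"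

end

theory Submission
  imports Defs
begin

text \<open>
  Write \<open>M = \<Oplus>\<^bsub>U\<^esub> W\<^sub>U\<close> with \<open>W\<^sub>U = 0\<close> for \<open>|U| > k\<close>. Fix \<open>N\<close> and work inside the single group \<open>V\<^sub>N\<close>:
  let \<open>I S\<close> be the image of \<open>V\<^sub>S\<close> and let \<open>R B\<close> be the set of those \<open>v\<close> whose image in \<open>M\<^sub>N\<close> has no
  component at any \<open>U \<supseteq> B\<close>. Passing from \<open>V\<close> to \<open>V\<close> modulo \<open>R B\<close> plays the role of the \<open>|B|\<close>-fold
  derivative, which lowers both \<open>k\<close> and \<open>d\<close> by \<open>|B|\<close>. Two vanishing statements feed each other
  in a descending induction on \<open>|B|\<close>, which starts at \<open>|B| > k\<close>, where \<open>R B\<close> is everything: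
  the cokernel of \<open>V \<rightarrow> M\<close> has no torsion after \<open>|B|\<close> derivatives, and relations between elements of
  the faces \<open>I (N - {i})\<close> split into relations on single faces. Splitting for larger \<open>B\<close> gives
  torsion-freeness at \<open>B\<close>, because a torsion class coming from a face avoiding \<open>i\<close> can be renamed
  away; torsion-freeness for all \<open>C \<supseteq> B\<close> gives splitting at \<open>B\<close>. Splitting at \<open>B = \<emptyset>\<close> is the
  claim.
\<close>

section \<open>Products in commutative groups\<close>

lemma (in comm_group) finprod_in_subgroup:
  assumes "subgroup H G" "\<And>i. i \<in> A \<Longrightarrow> f i \<in> H"
  shows "finprod G f A \<in> H"
  using assms(2)
proof (induction A rule: infinite_finite_induct)
  case (insert a A)
  then have "f \<in> A \<rightarrow> carrier G" "f a \<in> carrier G"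
    using subgroup.subset[OF assms(1)] by auto
  with insert show ?case
    by (simp add: subgroup.m_closed[OF assms(1)])
qed (simp_all add: subgroup.one_closed[OF assms(1)])

lemma (in comm_group) cancel_common_factor:
  assumes "a \<in> carrier G" "b \<in> carrier G" "c \<in> carrier G"
  shows "(a \<otimes> b) \<otimes> inv (a \<otimes> c) = b \<otimes> inv c"
proof -
  have "(a \<otimes> b) \<otimes> inv (a \<otimes> c) = (a \<otimes> inv a) \<otimes> (b \<otimes> inv c)"
    using assms by (simp only: inv_mult m_closed inv_closed m_ac)
  then show ?thesis using assms by simp
qed

lemma (in comm_group) cancel_right_factor:
  assumes "a \<in> carrier G" "b \<in> carrier G"
  shows "b \<otimes> inv (a \<otimes> b) = inv a"
  using cancel_common_factor[of b \<one> a] assms by (simp add: m_comm)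

text \<open>Commutativity lets products be regrouped factor by factor, so the products with one
  factor from each \<open>H i\<close> already form a subgroup.\<close>

lemma (in comm_group) generate_UN_subgroups:
  assumes A: "finite A" and H: "\<And>i. i \<in> A \<Longrightarrow> subgroup (H i) G"
    and x: "x \<in> generate G (\<Union>i\<in>A. H i)"
  shows "\<exists>h. (\<forall>i\<in>A. h i \<in> H i) \<and> x = finprod G h A"
proof -
  have HG: "h i \<in> carrier G" if "i \<in> A" "\<forall>i\<in>A. h i \<in> H i" for h i
    using that subgroup.mem_carrier[OF H] by blast
  have single: "\<exists>h. (\<forall>i\<in>A. h i \<in> H i) \<and> y = finprod G h A" if "j \<in> A" "y \<in> H j" for j y
  proof (intro exI conjI)
    let ?h = "\<lambda>i. if j = i then y else \<one>"
    show "\<forall>i\<in>A. ?h i \<in> H i"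
      using that subgroup.one_closed[OF H] by auto
    show "y = finprod G ?h A"
      using finprod_singleton[of j A "\<lambda>_. y"] that A subgroup.mem_carrier[OF H] by auto
  qed
  show ?thesis
    using x
  proof (induction rule: generate.induct)
    case one
    show ?case
      using subgroup.one_closed[OF H] by (intro exI[of _ "\<lambda>_. \<one>"]) auto
  next
    case (incl h)
    then show ?case using single by blast
  next
    case (inv h)
    then obtain j where "j \<in> A" "h \<in> H j" by blast
    then show ?case using single subgroup.m_inv_closed[OF H] by blast
  next
    case (eng x y)
    obtain f g where f: "\<forall>i\<in>A. f i \<in> H i" "x = finprod G f A"
      and g: "\<forall>i\<in>A. g i \<in> H i" "y = finprod G g A"
      using eng.IH by blast
    have "x \<otimes> y = finprod G (\<lambda>i. f i \<otimes> g i) A"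
      using f g HG by (simp add: Pi_def)
    then show ?case
      using f g subgroup.m_closed[OF H] by (intro exI[of _ "\<lambda>i. f i \<otimes> g i"]) auto
  qed
qed

lemma (in comm_group) hom_finprod_comm_group:
  assumes H: "comm_group H" and h: "h \<in> hom G H" and f: "\<And>i. i \<in> A \<Longrightarrow> f i \<in> carrier G"
  shows "h (finprod G f A) = finprod H (\<lambda>i. h (f i)) A"
proof -
  interpret H: comm_group H by fact
  have hc: "h x \<in> carrier H" if "x \<in> carrier G" for x
    using h that by (auto simp: hom_def)
  have h1: "h \<one> = \<one>\<^bsub>H\<^esub>"
    using hom_one[OF h] is_group H.is_group by blast
  show ?thesis
    using f
  proof (induction A rule: infinite_finite_induct)
    case (insert a A)
    then have "f \<in> A \<rightarrow> carrier G" "f a \<in> carrier G" "(\<lambda>i. h (f i)) \<in> A \<rightarrow> carrier H"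
      using hc by auto
    with insert show ?case
      by (simp add: hom_mult[OF h] hc)
  qed (simp_all add: h1)
qed

section \<open>Filtered cubes of subgroups\<close>

text \<open>This is what the induction needs of an FI-module, expressed by subgroups of one abelian
  group. \<open>R_top\<close> carries the bound \<open>k\<close> on the free target and
  \<open>I_generated\<close> the bound \<open>d\<close> on the source; \<open>swap\<close> records a
  map that is not an inclusion, the renaming of \<open>c\<close> to \<open>i\<close>.\<close>

locale filtered_cube = comm_group G for G :: "('g, 'z) monoid_scheme" (structure) +
  fixes N :: "'a set" and I R :: "'a set \<Rightarrow> 'g set" and k d :: nat
  assumes finite_N: "finite N"
    and subgroup_I: "S \<subseteq> N \<Longrightarrow> subgroup (I S) G"
    and I_mono: "S \<subseteq> T \<Longrightarrow> T \<subseteq> N \<Longrightarrow> I S \<subseteq> I T"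
    and subgroup_R: "B \<subseteq> N \<Longrightarrow> subgroup (R B) G"
    and R_mono: "B \<subseteq> C \<Longrightarrow> C \<subseteq> N \<Longrightarrow> R B \<subseteq> R C"
    and I_subset_R: "S \<subseteq> N \<Longrightarrow> B \<subseteq> N \<Longrightarrow> i \<in> B \<Longrightarrow> i \<notin> S \<Longrightarrow> I S \<subseteq> R B"
    and R_top: "B \<subseteq> N \<Longrightarrow> k < card B \<Longrightarrow> R B = carrier G"
    and I_generated: "S \<subseteq> N \<Longrightarrow> d < card S \<Longrightarrow> x \<in> I S \<Longrightarrow>
          \<exists>h. (\<forall>i\<in>S. h i \<in> I (S - {i})) \<and> x = finprod G h S"
    and swap: "B \<subseteq> S \<Longrightarrow> c \<notin> S \<Longrightarrow> i \<notin> S \<Longrightarrow> c \<noteq> i \<Longrightarrow> insert c (insert i S) \<subseteq> N \<Longrightarrow>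
          x \<in> I (insert c S) \<Longrightarrow> x \<in> R (insert c B) \<Longrightarrow>
          \<exists>y\<in>I (insert i S). \<exists>r\<in>R B. x = y \<otimes> r"
begin

text \<open>For \<open>c \<in> E - B\<close> this is injectivity, from \<open>E - {c}\<close> to
  \<open>E\<close>, of the cokernel of \<open>V \<rightarrow> M\<close> after the derivatives in
  \<open>B\<close>: membership in \<open>R (insert c B)\<close> says that the image of
  \<open>x\<close>, seen at sets above \<open>B\<close>, lives over \<open>E - {c}\<close>, and it
  then has to come from \<open>V\<close> over \<open>E - {c}\<close>.\<close>

definition torsion_free_at :: "'a set \<Rightarrow> 'a set \<Rightarrow> 'a \<Rightarrow> bool" where
  "torsion_free_at B E c \<longleftrightarrow>
     (\<forall>x \<in> I E \<inter> R (insert c B). \<exists>y\<in>I (E - {c}). \<exists>r\<in>R B. x = y \<otimes> r)"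

section \<open>Splitting relations between faces modulo \<open>R B\<close>\<close>

lemma I_carrier: "S \<subseteq> N \<Longrightarrow> x \<in> I S \<Longrightarrow> x \<in> carrier G"
  by (rule subgroup.mem_carrier[OF subgroup_I])

lemma R_carrier: "B \<subseteq> N \<Longrightarrow> x \<in> R B \<Longrightarrow> x \<in> carrier G"
  by (rule subgroup.mem_carrier[OF subgroup_R])

text \<open>The elements of \<open>A\<close> are removed one at a time: torsion-freeness splits off
  a factor from the face \<open>I (E - {c})\<close>, and the remainder lies in \<open>R\<close> of a
  set without \<open>c\<close>.\<close>

lemma decompose_in_R:
  assumes tf: "\<And>C c. B \<subseteq> C \<Longrightarrow> C \<subseteq> E \<Longrightarrow> c \<in> E - C \<Longrightarrow> torsion_free_at C E c"
    and BE: "B \<subseteq> E" "E \<subseteq> N" and A: "A \<subseteq> E" "A \<inter> B = {}"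
    and x: "x \<in> I E" "x \<in> R (A \<union> B)"
  shows "\<exists>h. (\<forall>i\<in>A. h i \<in> I (E - {i})) \<and> (\<exists>r\<in>R B. x = finprod G h A \<otimes> r)"
proof -
  have "finite A" using A BE finite_N by (meson finite_subset)
  then show ?thesis
    using A x
  proof (induction A arbitrary: x)
    case empty
    then show ?case using R_carrier[of B x] BE by (auto intro!: bexI[of _ x])
  next
    case (insert c A)
    have sub: "A \<union> B \<subseteq> N" "E - {c} \<subseteq> N" "B \<subseteq> N" "\<And>i. E - {i} \<subseteq> N"
      using insert.prems BE by auto
    have "torsion_free_at (A \<union> B) E c"
      using insert.prems insert.hyps BE by (intro tf) auto
    then obtain y r where y: "y \<in> I (E - {c})" and r: "r \<in> R (A \<union> B)" and xy: "x = y \<otimes> r"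
      using insert.prems unfolding torsion_free_at_def by fastforce
    have yc: "y \<in> carrier G" and rc: "r \<in> carrier G"
      using y r sub I_carrier R_carrier by blast+
    have yE: "y \<in> I E" using y I_mono[of "E - {c}" E] BE by auto
    \<comment> \<open>The remainder has to lie in \<open>I E\<close> again for the induction
      hypothesis to apply.\<close>
    have "r = inv y \<otimes> x"
      using xy yc rc by (simp add: m_assoc[symmetric])
    also have "\<dots> \<in> I E"
      using yE insert.prems BE subgroup_I
      by (simp add: subgroup.m_closed subgroup.m_inv_closed)
    finally obtain h s where h: "\<forall>i\<in>A. h i \<in> I (E - {i})" and s: "s \<in> R B"
      and rs: "r = finprod G h A \<otimes> s"
      using insert.IH[of r] insert.prems r by auto
    have hc: "h \<in> A \<rightarrow> carrier G" using h I_carrier[OF sub(4)] by auto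
    let ?h = "h(c := y)"
    have "finprod G ?h (insert c A) = y \<otimes> finprod G h A"
    proof -
      have "finprod G ?h A = finprod G h A"
        using hc insert.hyps by (intro finprod_cong') auto
      moreover have "?h \<in> A \<rightarrow> carrier G" using hc yc by auto
      ultimately show ?thesis
        using insert.hyps yc by simp
    qed
    then have "x = finprod G ?h (insert c A) \<otimes> s"
      using xy rs yc hc s R_carrier[OF sub(3)] by (simp add: m_assoc)
    moreover have "\<forall>i\<in>insert c A. ?h i \<in> I (E - {i})"
      using h y insert.hyps by auto
    ultimately show ?case using s by blast
  qed
qed

text \<open>Vanishing of a first homology group of the cube modulo \<open>R B\<close>: a relation between elements
  of the faces \<open>I (E - {i})\<close> becomes, after adding terms of codimension two whose total is zero,
  a collection of relations each supported on one face.\<close>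
lemma split_relation:
  assumes tf: "\<And>C E c. B \<subseteq> C \<Longrightarrow> C \<subseteq> E \<Longrightarrow> E \<subseteq> N \<Longrightarrow> c \<in> E - C \<Longrightarrow> k + d < card E + card C \<Longrightarrow>
      torsion_free_at C E c"
    and BE: "B \<subseteq> E" "E \<subseteq> N" and A: "A \<subseteq> E" "A \<inter> B = {}"
    and card: "k + d + 1 < card E + card B"
    and m: "\<And>i. i \<in> A \<Longrightarrow> m i \<in> I (E - {i})" "finprod G m A \<in> R B"
  shows "\<exists>m'. (\<forall>i\<in>A. m' i \<in> I (E - {i}) \<inter> R B) \<and> finprod G m' A = finprod G m A"
proof -
  have "finite A" using A BE finite_N by (meson finite_subset)
  then show ?thesis
    using A m
  proof (induction A arbitrary: m)
    case empty
    then show ?case by auto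
  next
    case (insert c A)
    have sub: "A \<union> B \<subseteq> N" "E - {c} \<subseteq> N" "B \<subseteq> N" "\<And>i. E - {i} \<subseteq> N" "c \<in> E"
      using insert.prems BE by auto
    have fE: "finite E" using BE finite_N by (meson finite_subset)
    have mc: "m c \<in> carrier G" and mA: "m \<in> A \<rightarrow> carrier G"
      using insert.prems I_carrier[OF sub(4)] by auto
    define p where "p = finprod G m A"
    have pc: "p \<in> carrier G" unfolding p_def using mA by simp
    have mp: "m c \<otimes> p \<in> R B"
      using insert.prems insert.hyps mc mA unfolding p_def by simp
    \<comment> \<open>Each \<open>m i\<close> comes from a face avoiding \<open>i \<in> A\<close>,
      so \<open>p\<close> lies in \<open>R (A \<union> B)\<close>; the relation
      \<open>m c \<otimes> p \<in> R B\<close> carries this over to \<open>m c\<close>.\<close>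
    have "m i \<in> R (A \<union> B)" if "i \<in> A" for i
      using that insert.prems(3)[of i] I_subset_R[OF sub(4), of "A \<union> B" i i] sub by auto
    then have pR: "p \<in> R (A \<union> B)"
      unfolding p_def using finprod_in_subgroup[OF subgroup_R[OF sub(1)]] by auto
    define x where "x = inv (m c)"
    have xc: "x \<in> carrier G" unfolding x_def using mc by simp
    have "x = p \<otimes> inv (m c \<otimes> p)"
      unfolding x_def using mc pc by (simp add: cancel_right_factor)
    then have xR: "x \<in> R (A \<union> B)"
      using pR mp R_mono[of B "A \<union> B"] sub subgroup_R[OF sub(1)]
      by (auto simp: subgroup.m_closed subgroup.m_inv_closed)
    have xI: "x \<in> I (E - {c})"
      unfolding x_def using insert.prems(3)[of c] subgroup_I[OF sub(2)]
      by (simp add: subgroup.m_inv_closed)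
    \<comment> \<open>The \<open>h i\<close> are the terms of codimension two. Torsion-freeness is
      used over \<open>E - {c}\<close>, which has one element less than \<open>E\<close>; this
      accounts for the extra \<open>1\<close> in the hypothesis \<open>card\<close>.\<close>
    have "\<exists>h. (\<forall>i\<in>A. h i \<in> I (E - {c} - {i})) \<and> (\<exists>r\<in>R B. x = finprod G h A \<otimes> r)"
    proof (rule decompose_in_R)
      fix C e assume C: "B \<subseteq> C" "C \<subseteq> E - {c}" "e \<in> E - {c} - C"
      have "card B \<le> card C" using C sub fE by (meson card_mono finite_Diff finite_subset)
      moreover have "card (E - {c}) = card E - 1" using sub fE by simp
      ultimately have "k + d < card (E - {c}) + card C" using card by simp
      then show "torsion_free_at C (E - {c}) e" using C sub by (intro tf) auto
    qed (use insert.prems insert.hyps sub BE xI xR in auto)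
    then obtain h r where h: "\<And>i. i \<in> A \<Longrightarrow> h i \<in> I (E - {c} - {i})" and r: "r \<in> R B"
      and xr: "x = finprod G h A \<otimes> r" by blast
    have hI: "h i \<in> I (E - {i})" "h i \<in> I (E - {c})" if "i \<in> A" for i
      using h[OF that] I_mono[of "E - {c} - {i}" "E - {i}"] I_mono[of "E - {c} - {i}" "E - {c}"] sub
      by auto
    have hc: "h \<in> A \<rightarrow> carrier G" using hI I_carrier[OF sub(4)] by auto
    \<comment> \<open>Each \<open>h i\<close> lies on the faces opposite \<open>i\<close> and
      \<open>c\<close>. It is divided out of \<open>m i\<close> and multiplied into
      \<open>m c\<close>, which keeps the total. Now \<open>m c \<otimes> q = inv r\<close> is in
      \<open>R B\<close>, and a relation over \<open>A\<close> alone remains.\<close>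
    define q where "q = finprod G h A"
    have qc: "q \<in> carrier G" unfolding q_def using hc by simp
    have rc: "r \<in> carrier G" using r R_carrier sub by blast
    have "m c = inv x" unfolding x_def using mc by simp
    then have mcq: "m c \<otimes> q = inv r"
      unfolding xr q_def[symmetric] using cancel_right_factor[OF rc qc] qc rc by (simp add: m_comm)
    have sum: "finprod G (\<lambda>i. m i \<otimes> inv (h i)) A = p \<otimes> inv q"
    proof -
      have "finprod G (\<lambda>i. m i \<otimes> inv (h i)) A \<otimes> q = p"
      proof -
        have "finprod G (\<lambda>i. m i \<otimes> inv (h i)) A \<otimes> q
            = finprod G (\<lambda>i. m i \<otimes> inv (h i) \<otimes> h i) A"
          unfolding q_def using mA hc by (subst finprod_multf) (auto simp: Pi_iff)
        also have "\<dots> = p"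
          unfolding p_def using mA hc by (intro finprod_cong') (auto simp: m_assoc Pi_iff)
        finally show ?thesis .
      qed
      moreover have "finprod G (\<lambda>i. m i \<otimes> inv (h i)) A \<in> carrier G"
        using mA hc by (auto simp: Pi_iff)
      ultimately show ?thesis using qc by (metis inv_solve_right pc)
    qed
    moreover have "p \<otimes> inv q = (m c \<otimes> p) \<otimes> inv (m c \<otimes> q)"
      using mc pc qc by (simp add: cancel_common_factor)
    moreover have "\<dots> \<in> R B"
      unfolding mcq using mp r rc subgroup_R[OF sub(3)] by (simp add: subgroup.m_closed)
    moreover have "m i \<otimes> inv (h i) \<in> I (E - {i})" if "i \<in> A" for i
      using hI(1)[OF that] insert.prems(3)[of i] that subgroup_I[OF sub(4)]
      by (simp add: subgroup.m_closed subgroup.m_inv_closed)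
    ultimately obtain m' where m': "\<forall>i\<in>A. m' i \<in> I (E - {i}) \<inter> R B"
      and m's: "finprod G m' A = p \<otimes> inv q"
      using insert.IH[of "\<lambda>i. m i \<otimes> inv (h i)"] insert.prems by auto
    have m'c: "m' \<in> A \<rightarrow> carrier G" using m' R_carrier[OF sub(3)] by auto
    let ?m = "m'(c := m c \<otimes> q)"
    have "finprod G ?m (insert c A) = (p \<otimes> inv q) \<otimes> (m c \<otimes> q)"
    proof -
      have "finprod G ?m A = finprod G m' A"
        using m'c insert.hyps by (intro finprod_cong') auto
      moreover have "?m \<in> A \<rightarrow> carrier G" using m'c mc qc by auto
      ultimately show ?thesis
        using insert.hyps mc qc pc m's by (simp add: m_comm)
    qed
    also have "\<dots> = p \<otimes> (inv q \<otimes> q) \<otimes> m c"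
      using mc pc qc by (simp only: m_ac m_closed inv_closed)
    also have "\<dots> = m c \<otimes> p"
      using mc pc qc by (simp add: m_comm)
    also have "\<dots> = finprod G m (insert c A)"
      unfolding p_def using insert.hyps mc mA by simp
    finally have "finprod G ?m (insert c A) = finprod G m (insert c A)" .
    moreover have "m c \<otimes> q \<in> I (E - {c}) \<inter> R B"
    proof
      show "m c \<otimes> q \<in> R B"
        unfolding mcq using r subgroup_R[OF sub(3)] by (simp add: subgroup.m_inv_closed)
      have "q \<in> I (E - {c})"
        unfolding q_def using finprod_in_subgroup[OF subgroup_I[OF sub(2)]] hI by auto
      then show "m c \<otimes> q \<in> I (E - {c})"
        using insert.prems(3)[of c] subgroup_I[OF sub(2)] by (simp add: subgroup.m_closed)
    qed
    ultimately show ?case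
      using m' by (intro exI[of _ ?m] conjI ballI) (auto simp del: fun_upd_apply simp: fun_upd_def)
  qed
qed

text \<open>Descending induction on \<open>card B\<close>; the measure \<open>Suc k - card B\<close>
  is zero exactly when \<open>R_top\<close> applies. Otherwise \<open>card B \<le> k\<close> forces
  \<open>d < card E\<close>, so \<open>x\<close> is a product of elements of faces of
  \<open>E\<close>.\<close>

lemma torsion_free:
  assumes "B \<subseteq> E" "E \<subseteq> N" "c \<in> E - B" "k + d < card E + card B"
  shows "torsion_free_at B E c"
  using assms
proof (induction "Suc k - card B" arbitrary: B E c rule: less_induct)
  case less
  have fE: "finite E" using less.prems finite_N by (meson finite_subset)
  have sub: "B \<subseteq> N" "\<And>i. E - {i} \<subseteq> N" "insert c B \<subseteq> N" using less.prems by auto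
  have fB: "finite B" using sub finite_N by (meson finite_subset)
  show ?case
  proof (cases "k < card B")
    case True
    have "R B = carrier G" by (rule R_top[OF sub(1) True])
    moreover have "\<one> \<in> I (E - {c})" by (rule subgroup.one_closed[OF subgroup_I[OF sub(2)]])
    ultimately show ?thesis
      unfolding torsion_free_at_def using I_carrier less.prems by (metis IntD1 l_one)
  next
    case False
    show ?thesis
      unfolding torsion_free_at_def
    proof
      fix x assume x: "x \<in> I E \<inter> R (insert c B)"
      then obtain e where e: "\<And>i. i \<in> E \<Longrightarrow> e i \<in> I (E - {i})" and xe: "x = finprod G e E"
        using I_generated[of E x] less.prems False by auto
      have ec: "e i \<in> carrier G" if "i \<in> E" for i
        using that e I_carrier[OF sub(2)] by blast
      \<comment> \<open>The factor \<open>e c\<close> already lies in \<open>I (E - {c})\<close> and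
        the factors indexed by \<open>B\<close> lie in \<open>R B\<close>, so only those indexed by
        \<open>T\<close> have to be moved.\<close>
      define T where "T = E - insert c B"
      have E: "E = insert c (T \<union> B)" and T: "T \<subseteq> E" "finite T" "c \<notin> T \<union> B" "T \<inter> B = {}"
        unfolding T_def using less.prems fE by auto
      define p q where "p = finprod G e T" and "q = finprod G e B"
      have pc: "p \<in> carrier G" and qc: "q \<in> carrier G"
        unfolding p_def q_def using ec T less.prems by (auto intro!: finprod_closed)
      have xpq: "x = e c \<otimes> (p \<otimes> q)"
      proof -
        have "x = e c \<otimes> finprod G e (T \<union> B)"
          unfolding xe using E T fB ec by (subst E) (auto simp: Pi_iff)
        then show ?thesis
          unfolding p_def q_def using T fB ec less.prems
          by (subst (asm) finprod_Un_disjoint) (auto simp: Pi_iff)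
      qed
      have eR: "e i \<in> R B" if "i \<in> B" for i
        using e[of i] that I_subset_R[OF sub(2) sub(1), of i i] less.prems by auto
      have qR: "q \<in> R B"
        unfolding q_def using finprod_in_subgroup[OF subgroup_R[OF sub(1)]] eR by auto
      have ecR: "e c \<in> R (insert c B)"
        using e[of c] I_subset_R[OF sub(2) sub(3), of c c] less.prems by auto
      have "c \<in> E" using less.prems by simp
      note ecc = ec[OF this]
      have "p = x \<otimes> inv (e c \<otimes> q)"
        unfolding xpq using cancel_common_factor[of "e c \<otimes> q" p \<one>] pc qc ecc by (simp add: m_ac)
      also have "\<dots> \<in> R (insert c B)"
        using x ecR qR R_mono[OF subset_insertI sub(3)] subgroup_R[OF sub(3)]
        by (simp add: subgroup.m_closed subgroup.m_inv_closed subset_iff)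
      finally have pR: "p \<in> R (insert c B)" .
      have cB: "card (insert c B) = Suc (card B)"
        using less.prems fB by simp
      \<comment> \<open>Splitting is applied above \<open>insert c B\<close>: the additional element
        supplies the \<open>1\<close> that its bound demands, and it relies on torsion-freeness only
        at sets larger than \<open>B\<close>.\<close>
      have "\<exists>m'. (\<forall>i\<in>T. m' i \<in> I (E - {i}) \<inter> R (insert c B)) \<and> finprod G m' T = finprod G e T"
      proof (rule split_relation)
        fix C E' e' assume C: "insert c B \<subseteq> C" "C \<subseteq> E'" "E' \<subseteq> N" "e' \<in> E' - C"
          "k + d < card E' + card C"
        have "finite C" using C finite_N by (meson finite_subset)
        then have "card B < card C" using C card_mono[of C "insert c B"] cB by simp
        then show "torsion_free_at C E' e'"
          using C False by (intro less.hyps) auto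
      qed (use less.prems T e pR cB in \<open>auto simp: p_def\<close>)
      then obtain m' where m': "\<And>i. i \<in> T \<Longrightarrow> m' i \<in> I (E - {i})"
          "\<And>i. i \<in> T \<Longrightarrow> m' i \<in> R (insert c B)" and m'p: "p = finprod G m' T"
        unfolding p_def by fastforce
      \<comment> \<open>\<open>m' i\<close> involves \<open>c\<close> but not \<open>i\<close>; modulo \<open>R B\<close> it does not depend on \<open>c\<close> either, so \<open>c\<close>
        may be renamed to \<open>i\<close>.\<close>
      have "\<exists>y\<in>I (E - {c}). \<exists>r\<in>R B. m' i = y \<otimes> r" if i: "i \<in> T" for i
      proof -
        have "insert c (E - {c, i}) = E - {i}" "insert i (E - {c, i}) = E - {c}"
          using i T less.prems by auto
        moreover have "B \<subseteq> E - {c, i}" "c \<noteq> i" "insert c (insert i (E - {c, i})) \<subseteq> N"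
          using i T less.prems by auto
        ultimately show ?thesis
          using swap[of B "E - {c, i}" c i "m' i"] m'[OF i] by auto
      qed
      then obtain y r where y: "\<And>i. i \<in> T \<Longrightarrow> y i \<in> I (E - {c})"
        and r: "\<And>i. i \<in> T \<Longrightarrow> r i \<in> R B" and yr: "\<And>i. i \<in> T \<Longrightarrow> m' i = y i \<otimes> r i"
        by metis
      have yc: "y \<in> T \<rightarrow> carrier G" and rc: "r \<in> T \<rightarrow> carrier G"
        using y r I_carrier[OF sub(2)] R_carrier[OF sub(1)] by auto
      have "p = finprod G (\<lambda>i. y i \<otimes> r i) T"
        unfolding m'p using yc rc yr by (intro finprod_cong') auto
      then have pyr: "p = finprod G y T \<otimes> finprod G r T"
        using yc rc by simp
      have yI: "finprod G y T \<in> I (E - {c})"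
        using finprod_in_subgroup[OF subgroup_I[OF sub(2)]] y by auto
      have rR: "finprod G r T \<in> R B"
        using finprod_in_subgroup[OF subgroup_R[OF sub(1)]] r by auto
      have "x = (e c \<otimes> finprod G y T) \<otimes> (finprod G r T \<otimes> q)"
        unfolding xpq pyr using ecc qc yc rc by (simp add: m_ac)
      moreover have "e c \<otimes> finprod G y T \<in> I (E - {c})"
        using yI e[of c] less.prems subgroup_I[OF sub(2)] by (simp add: subgroup.m_closed)
      moreover have "finprod G r T \<otimes> q \<in> R B"
        using rR qR subgroup_R[OF sub(1)] by (simp add: subgroup.m_closed)
      ultimately show "\<exists>y\<in>I (E - {c}). \<exists>r\<in>R B. x = y \<otimes> r" by blast
    qed
  qed
qed

text \<open>\<open>R {}\<close> plays the part of the kernel. A factorization of \<open>x\<close>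
  into face elements is a relation modulo \<open>R {}\<close>, and splitting moves every factor into
  \<open>R {}\<close>.\<close>

theorem split_kernel_element:
  assumes card: "k + d + 1 < card N" and x: "x \<in> I N" "x \<in> R {}"
  shows "\<exists>m. (\<forall>i\<in>N. m i \<in> I (N - {i}) \<inter> R {}) \<and> x = finprod G m N"
proof -
  obtain h where h: "\<forall>i\<in>N. h i \<in> I (N - {i})" "x = finprod G h N"
    using I_generated[of N x] card x by auto
  have "\<exists>m'. (\<forall>i\<in>N. m' i \<in> I (N - {i}) \<inter> R {}) \<and> finprod G m' N = finprod G h N"
    by (rule split_relation) (use torsion_free card h x in auto)
  then show ?thesis using h by auto
qed

end

section \<open>FI-modules\<close>

lemma FI_module_comm_group: "FI_module W \<Longrightarrow> finite S \<Longrightarrow> comm_group (obj W S)"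
  by (simp add: FI_module_def functor_to_Zmod_def)

lemma FI_module_mor_hom:
  "FI_module W \<Longrightarrow> f \<in> FI_hom S T \<Longrightarrow> finite S \<Longrightarrow> finite T \<Longrightarrow>
    mor W S T f \<in> hom (obj W S) (obj W T)"
  by (simp add: FI_module_def functor_to_Zmod_def)

lemma FI_module_mor_closed:
  "FI_module W \<Longrightarrow> f \<in> FI_hom S T \<Longrightarrow> finite S \<Longrightarrow> finite T \<Longrightarrow> v \<in> carrier (obj W S) \<Longrightarrow>
    mor W S T f v \<in> carrier (obj W T)"
  using FI_module_mor_hom by (blast intro: hom_in_carrier)

lemma FI_module_mor_id:
  "FI_module W \<Longrightarrow> finite S \<Longrightarrow> v \<in> carrier (obj W S) \<Longrightarrow> mor W S S (\<lambda>x\<in>S. x) v = v"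
  by (simp add: FI_module_def functor_to_Zmod_def)

lemma FI_module_mor_compose:
  "FI_module W \<Longrightarrow> f \<in> FI_hom S T \<Longrightarrow> g \<in> FI_hom T U \<Longrightarrow> finite S \<Longrightarrow> finite T \<Longrightarrow> finite U \<Longrightarrow>
    v \<in> carrier (obj W S) \<Longrightarrow> mor W T U g (mor W S T f v) = mor W S U (compose S g f) v"
  by (simp add: FI_module_def functor_to_Zmod_def)

lemma inclusion_FI_hom: "S \<subseteq> T \<Longrightarrow> (\<lambda>x\<in>S. x) \<in> FI_hom S T"
  by (auto simp: FI_hom_def inj_on_def)

text \<open>Inclusions need not act injectively on \<open>W\<close>, so within the group at
  \<open>T\<close> the group at \<open>S\<close> is seen only through its image.\<close>

definition image_in :: "'v fin_functor \<Rightarrow> nat set \<Rightarrow> nat set \<Rightarrow> 'v set" where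
  "image_in W S T = mor W S T (\<lambda>x\<in>S. x) ` carrier (obj W S)"

lemma image_in_subgroup:
  assumes W: "FI_module W" and ST: "S \<subseteq> T" "finite T"
  shows "subgroup (image_in W S T) (obj W T)"
proof -
  have S: "finite S" using ST finite_subset by blast
  interpret S: comm_group "obj W S" using FI_module_comm_group[OF W S] .
  interpret T: comm_group "obj W T" using FI_module_comm_group[OF W ST(2)] .
  interpret group_hom "obj W S" "obj W T" "mor W S T (\<lambda>x\<in>S. x)"
    using FI_module_mor_hom[OF W inclusion_FI_hom[OF ST(1)] S ST(2)]
    by (intro group_hom.intro group_hom_axioms.intro S.is_group T.is_group)
  show ?thesis unfolding image_in_def by (rule img_is_subgroup)
qed

text \<open>\<open>f\<close> factors as an injection into \<open>U\<close> followed by the inclusion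
  of \<open>U\<close> in \<open>T\<close>.\<close>

lemma mor_mem_image_in:
  assumes W: "FI_module W" and f: "f \<in> FI_hom S T" "f ` S \<subseteq> U"
    and UT: "U \<subseteq> T" "finite S" "finite T" and v: "v \<in> carrier (obj W S)"
  shows "mor W S T f v \<in> image_in W U T"
proof -
  have U: "finite U" using UT finite_subset by blast
  have fU: "f \<in> FI_hom S U"
    using f by (auto simp: FI_hom_def PiE_iff)
  have "f = compose S (\<lambda>x\<in>U. x) f"
    using fU by (auto simp: compose_def FI_hom_def fun_eq_iff PiE_iff extensional_def Pi_iff)
  then have "mor W S T f v = mor W U T (\<lambda>x\<in>U. x) (mor W S U f v)"
    using FI_module_mor_compose[OF W fU inclusion_FI_hom[OF UT(1)] UT(2) U UT(3) v] by simp
  then show ?thesis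
    unfolding image_in_def using FI_module_mor_closed[OF W fU UT(2) U v] by simp
qed

section \<open>Generation degree and generation by faces\<close>

lemma generated_in_degree_le_iff:
  "generated_in_degree_le W m \<longleftrightarrow> (\<forall>n>m. trivial_group (H0 W {1..n}))"
proof
  assume "generated_in_degree_le W m"
  then have le: "degree_FI (H0 W) \<le> ereal (real m)"
    by (simp add: generated_in_degree_le_def)
  show "\<forall>n>m. trivial_group (H0 W {1..n})"
  proof (intro allI impI)
    fix n assume "m < n"
    then have "degree_FI (H0 W) < ereal (real n)"
      using le by (meson le_less_trans less_ereal.simps(1) of_nat_less_iff)
    then show "trivial_group (H0 W {1..n})"
      unfolding degree_FI_def by (auto simp: Inf_less_iff)
  qed
next
  assume "\<forall>n>m. trivial_group (H0 W {1..n})"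
  then show "generated_in_degree_le W m"
    unfolding generated_in_degree_le_def degree_FI_def by (intro Inf_lower) auto
qed

lemma (in comm_group) trivial_quotient_iff:
  assumes "K \<subseteq> carrier G"
  shows "trivial_group (G Mod generate G K) \<longleftrightarrow> generate G K = carrier G"
proof -
  let ?H = "generate G K"
  have H: "subgroup ?H G" using generate_is_subgroup[OF assms] .
  interpret N: normal ?H G using subgroup_imp_normal[OF H] .
  have "trivial_group (G Mod ?H) \<longleftrightarrow> (\<forall>x\<in>carrier G. ?H #> x = ?H)"
    unfolding trivial_group_def
    using N.factorgroup_is_group
    by (auto simp: FactGroup_def RCOSETS_def)
  also have "\<dots> \<longleftrightarrow> carrier G \<subseteq> ?H"
    using coset_join1[OF _ _ H] coset_join2[OF _ H] subgroup.subset[OF H]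
    by (auto simp: subset_iff)
  finally show ?thesis using subgroup.subset[OF H] by auto
qed

lemma generated_by_smaller:
  assumes W: "FI_module W" and gen: "generated_in_degree_le W m" and n: "m < n"
  shows "carrier (obj W {1..n}) = generate (obj W {1..n})
    (\<Union>{mor W S {1..n} f ` carrier (obj W S) | S f. finite S \<and> card S < card {1..n} \<and> f \<in> FI_hom S {1..n}})"
    (is "_ = generate _ ?K")
proof -
  interpret comm_group "obj W {1..n}" using FI_module_comm_group[OF W] by simp
  have "?K \<subseteq> carrier (obj W {1..n})"
    by (auto intro!: FI_module_mor_closed[OF W])
  moreover have "trivial_group (obj W {1..n} Mod generate (obj W {1..n}) ?K)"
    using gen n unfolding generated_in_degree_le_iff H0_def by simp
  ultimately show ?thesis by (simp only: trivial_quotient_iff)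
qed

text \<open>The degree tests only the sets \<open>{1..n}\<close>, so generation is carried to
  \<open>T\<close> along a bijection. An injection from a smaller set misses some
  \<open>i \<in> T\<close> and hence factors through \<open>T - {i}\<close>.\<close>

lemma generated_by_faces:
  assumes W: "FI_module W" and gen: "generated_in_degree_le W m" and T: "finite T" "m < card T"
    and v: "v \<in> carrier (obj W T)"
  shows "v \<in> generate (obj W T)
    (\<Union>i\<in>T. image_in W (T - {i}) T)"
    (is "_ \<in> generate _ ?F")
proof -
  define n where "n = card T"
  define N where "N = {1..n}"
  have N: "finite N" "card N = n" unfolding N_def by auto
  interpret T: comm_group "obj W T" using FI_module_comm_group[OF W T(1)] .
  interpret N: comm_group "obj W N" using FI_module_comm_group[OF W N(1)] .
  have "?F \<subseteq> carrier (obj W T)"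
    using T by (intro UN_least subgroup.subset image_in_subgroup[OF W]) auto
  then have sF: "subgroup (generate (obj W T) ?F) (obj W T)"
    using T.generate_is_subgroup by blast
  have "\<exists>b. bij_betw b N T"
    unfolding N_def n_def by (rule ex_bij_betw_nat_finite_1[OF T(1)])
  then obtain b where b: "bij_betw b N T" ..
  define f where "f = restrict b N"
  define g where "g = restrict (inv_into N b) T"
  have f: "f \<in> FI_hom N T" "f ` N = T"
    using bij_betw_imp_inj_on[OF b] bij_betw_imp_surj_on[OF b]
    unfolding f_def FI_hom_def by auto
  have g: "g \<in> FI_hom T N"
    using bij_betw_imp_inj_on[OF bij_betw_inv_into[OF b]] bij_betw_imp_surj_on[OF bij_betw_inv_into[OF b]]
    unfolding g_def FI_hom_def by auto
  have fg: "compose T f g = (\<lambda>x\<in>T. x)"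
    using b bij_betw_inv_into[OF b] unfolding f_def g_def compose_def
    by (intro restrict_ext) (simp add: bij_betw_inv_into_right bij_betw_apply)
  interpret f: group_hom "obj W N" "obj W T" "mor W N T f"
    using FI_module_mor_hom[OF W f(1)] T N
    by (intro group_hom.intro group_hom_axioms.intro) auto
  have "mor W N T f w \<in> generate (obj W T) ?F" if "w \<in> carrier (obj W N)" for w
  proof -
    let ?K = "\<Union>{mor W S N h ` carrier (obj W S) | S h. finite S \<and> card S < card N \<and> h \<in> FI_hom S N}"
    have sub: "?K \<subseteq> carrier (obj W N)"
      using N by (auto intro!: FI_module_mor_closed[OF W])
    have K: "mor W N T f w \<in> ?F" if w: "w \<in> ?K" for w
    proof -
      obtain S h u where S: "finite S" "card S < n" "h \<in> FI_hom S N" and u: "u \<in> carrier (obj W S)"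
        and w: "w = mor W S N h u"
        using w N by auto
      let ?fh = "compose S f h"
      have h: "h \<in> S \<rightarrow> N" "inj_on h S" using S by (auto simp: FI_hom_def)
      have fh: "?fh \<in> FI_hom S T"
        using h f by (auto simp: compose_def FI_hom_def inj_on_def Pi_iff)
      have "card (?fh ` S) < card T"
        using S(1,2) n_def card_image_le[of S ?fh] by simp
      then have "\<not> T \<subseteq> ?fh ` S"
        using card_mono[OF finite_imageI[OF S(1)]] by (meson not_less)
      then obtain i where i: "i \<in> T" "i \<notin> ?fh ` S" by blast
      then have fi: "?fh ` S \<subseteq> T - {i}"
        using fh by (auto simp: FI_hom_def)
      have "mor W N T f w = mor W S T ?fh u"
        unfolding w using FI_module_mor_compose[OF W S(3) f(1) S(1) N(1) T(1) u] by simp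
      then show ?thesis
        using i(1) mor_mem_image_in[OF W fh fi _ S(1) T(1) u] by auto
    qed
    have "w \<in> generate (obj W N) ?K"
      using that generated_by_smaller[OF W gen, of n] T n_def unfolding N_def by simp
    then show ?thesis
    proof (induction rule: generate.induct)
      case one
      then show ?case using subgroup.one_closed[OF sF] by simp
    next
      case (incl h)
      show ?case by (rule generate.incl[OF K[OF incl]])
    next
      case (inv h)
      then have "h \<in> carrier (obj W N)" by (rule subsetD[OF sub])
      then show ?case using generate.inv[OF K[OF inv], of "obj W T"] by simp
    next
      case (eng x y)
      then show ?case
        using N.generate_in_carrier[OF sub] subgroup.m_closed[OF sF] by simp
    qed
  qed
  \<comment> \<open>Since \<open>f\<close> after \<open>g\<close> is the identity, \<open>v\<close>
    is the image under \<open>f\<close> of an element over \<open>N\<close>.\<close>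
  moreover have "mor W T N g v \<in> carrier (obj W N)"
    using FI_module_mor_closed[OF W g] T N v by auto
  moreover have "mor W N T f (mor W T N g v) = v"
    using FI_module_mor_compose[OF W g f(1)] FI_module_mor_id[OF W] T N v fg by simp
  ultimately show ?thesis by metis
qed

section \<open>Maps into free FI-modules\<close>

text \<open>This is instantiated twice: for \<open>M\<close> with its isomorphism to
  \<open>M_free W\<close>, where the generation degree bounds the support of elements, and for
  \<open>V\<close> with the composite map.\<close>

locale map_to_free =
  fixes V :: "'v fin_functor" and W :: "'w fin_functor"
    and \<Psi> :: "nat set \<Rightarrow> 'v \<Rightarrow> nat set \<Rightarrow> 'w"
  assumes V: "FI_module V" and W: "FB_module W" and \<Psi>: "FI_module_hom V (M_free W) \<Psi>"
begin

lemma W_comm_group: "finite S \<Longrightarrow> comm_group (obj W S)"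
  using W by (simp add: FB_module_def functor_to_Zmod_def)

lemma W_group: "finite S \<Longrightarrow> group (obj W S)"
  using W_comm_group by (rule comm_group.axioms(2))

lemma W_mor_hom:
  "f \<in> FB_hom S T \<Longrightarrow> finite S \<Longrightarrow> finite T \<Longrightarrow> mor W S T f \<in> hom (obj W S) (obj W T)"
  using W by (simp add: FB_module_def functor_to_Zmod_def)

lemma W_mor_id: "finite S \<Longrightarrow> w \<in> carrier (obj W S) \<Longrightarrow> mor W S S (\<lambda>x\<in>S. x) w = w"
  using W by (simp add: FB_module_def functor_to_Zmod_def)

lemma \<Psi>_closed:
  assumes "finite S" "v \<in> carrier (obj V S)"
  shows "\<Psi> S v \<in> (\<Pi>\<^sub>E U\<in>Pow S. carrier (obj W U))"
proof -
  have "\<Psi> S v \<in> carrier (obj (M_free W) S)"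
    using \<Psi> assms by (auto simp: FI_module_hom_def intro: hom_in_carrier)
  moreover have group: "group (obj W U)" if "U \<in> Pow S" for U
    using W_group[OF finite_subset[OF PowD[OF that] assms(1)]] .
  moreover have "carrier (sum_group (Pow S) (obj W)) =
      {x \<in> \<Pi>\<^sub>E U\<in>Pow S. carrier (obj W U). finite {U \<in> Pow S. x U \<noteq> \<one>\<^bsub>obj W U\<^esub>}}"
    by (rule carrier_sum_group[OF group])
  ultimately show ?thesis by (simp add: M_free_def)
qed

lemma component_hom:
  assumes S: "finite S" and U: "U \<subseteq> S"
  shows "(\<lambda>v. \<Psi> S v U) \<in> hom (obj V S) (obj W U)"
proof (rule homI)
  fix v w assume v: "v \<in> carrier (obj V S)" and w: "w \<in> carrier (obj V S)"
  show "\<Psi> S v U \<in> carrier (obj W U)"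
    using \<Psi>_closed[OF S v] U by (auto simp: PiE_iff)
  have "\<Psi> S \<in> hom (obj V S) (obj (M_free W) S)"
    using \<Psi> S by (simp add: FI_module_hom_def)
  then have "\<Psi> S (v \<otimes>\<^bsub>obj V S\<^esub> w) = \<Psi> S v \<otimes>\<^bsub>obj (M_free W) S\<^esub> \<Psi> S w"
    using v w by (rule hom_mult)
  then show "\<Psi> S (v \<otimes>\<^bsub>obj V S\<^esub> w) U = \<Psi> S v U \<otimes>\<^bsub>obj W U\<^esub> \<Psi> S w U"
    using U by (simp add: M_free_def)
qed

lemma component_group_hom:
  assumes "finite S" "U \<subseteq> S"
  shows "group_hom (obj V S) (obj W U) (\<lambda>v. \<Psi> S v U)"
  using component_hom[OF assms] W_group[OF finite_subset[OF assms(2,1)]]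
    comm_group.axioms(2)[OF FI_module_comm_group[OF V assms(1)]]
  by (intro group_hom.intro group_hom_axioms.intro)

lemma component_mor:
  assumes f: "f \<in> FI_hom S T" and ST: "finite S" "finite T" and v: "v \<in> carrier (obj V S)"
    and U: "U \<subseteq> T"
  shows "\<Psi> T (mor V S T f v) U =
    (if U \<subseteq> f ` S
     then mor W (f -` U \<inter> S) U (restrict f (f -` U \<inter> S)) (\<Psi> S v (f -` U \<inter> S))
     else \<one>\<^bsub>obj W U\<^esub>)"
proof -
  have "\<Psi> T (mor V S T f v) = mor (M_free W) S T f (\<Psi> S v)"
    using \<Psi> f ST v by (simp add: FI_module_hom_def)
  then show ?thesis
    using U by (simp add: M_free_def Let_def)
qed

text \<open>The preimage of \<open>U \<subseteq> S\<close> under the inclusion is \<open>U\<close>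
  itself, and the transport map is the identity. So components over \<open>S\<close> can be
  recovered over \<open>T\<close>, even where the inclusion does not act injectively on
  \<open>V\<close>.\<close>

lemma component_inclusion:
  assumes ST: "S \<subseteq> T" "finite T" and v: "v \<in> carrier (obj V S)" and U: "U \<subseteq> T"
  shows "\<Psi> T (mor V S T (\<lambda>x\<in>S. x) v) U = (if U \<subseteq> S then \<Psi> S v U else \<one>\<^bsub>obj W U\<^esub>)"
proof -
  have fin: "finite S" "finite U" using ST U finite_subset by blast+
  have "\<Psi> S v U \<in> carrier (obj W U)" if "U \<subseteq> S"
    using \<Psi>_closed[OF fin(1) v] that by (auto simp: PiE_iff)
  moreover have "(\<lambda>x\<in>S. x) -` U \<inter> S = U" "restrict (\<lambda>x\<in>S. x) U = (\<lambda>x\<in>U. x)" if "U \<subseteq> S"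
    using that by (auto simp: restrict_def fun_eq_iff)
  moreover have "(\<lambda>x\<in>S. x) ` S = S" by auto
  ultimately show ?thesis
    using component_mor[OF inclusion_FI_hom[OF ST(1)] fin(1) ST(2) v U] W_mor_id[OF fin(2)]
    by simp
qed

text \<open>Since \<open>U \<subseteq> T\<close>, also \<open>k < card T\<close>, and
  \<open>v\<close> is generated by faces \<open>T - {i}\<close>. Such a face either does not contain
  \<open>U\<close> or is covered by induction. When \<open>\<Psi>\<close> is an isomorphism, this
  says that the FB-module \<open>W\<close> is trivial above degree \<open>k\<close>.\<close>

lemma component_eq_one:
  assumes gen: "generated_in_degree_le V k" and T: "finite T" "U \<subseteq> T" and U: "k < card U"
    and v: "v \<in> carrier (obj V T)"
  shows "\<Psi> T v U = \<one>\<^bsub>obj W U\<^esub>"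
  using T v
proof (induction "card T" arbitrary: T v rule: less_induct)
  case less
  interpret group_hom "obj V T" "obj W U" "\<lambda>v. \<Psi> T v U"
    using component_group_hom less.prems by blast
  let ?K = "kernel (obj V T) (obj W U) (\<lambda>v. \<Psi> T v U)"
  have "k < card T" using U card_mono[OF less.prems(1,2)] by simp
  then have v: "v \<in> generate (obj V T) (\<Union>i\<in>T. image_in V (T - {i}) T)"
    using generated_by_faces[OF V gen less.prems(1) _ less.prems(3)] by blast
  have "image_in V (T - {i}) T \<subseteq> ?K" if i: "i \<in> T" for i
  proof
    fix x assume x: "x \<in> image_in V (T - {i}) T"
    then obtain u where u: "u \<in> carrier (obj V (T - {i}))"
      and xu: "x = mor V (T - {i}) T (\<lambda>x\<in>T - {i}. x) u"
      unfolding image_in_def by blast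
    have "\<Psi> (T - {i}) u U = \<one>\<^bsub>obj W U\<^esub>" if "U \<subseteq> T - {i}"
      using less.hyps[OF _ _ that u] card_Diff1_less[OF less.prems(1) i] less.prems(1) by blast
    then have "\<Psi> T x U = \<one>\<^bsub>obj W U\<^esub>"
      unfolding xu using component_inclusion[OF _ less.prems(1) u less.prems(2)] by simp
    moreover have "x \<in> carrier (obj V T)"
      by (rule subgroup.mem_carrier[OF image_in_subgroup[OF V _ less.prems(1)] x]) auto
    ultimately show "x \<in> ?K" by (simp add: kernel_def)
  qed
  then have "generate (obj V T) (\<Union>i\<in>T. image_in V (T - {i}) T) \<subseteq> ?K"
    by (intro G.generate_subgroup_incl subgroup_kernel UN_least)
  with v show ?case by (auto simp: kernel_def)
qed

text \<open>The subgroup \<open>R B\<close> of the cube; at \<open>B = {}\<close> it is the kernel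
  of \<open>\<Psi> N\<close>.\<close>

definition vanishing_above :: "nat set \<Rightarrow> nat set \<Rightarrow> 'v set" where
  "vanishing_above N B =
     {v \<in> carrier (obj V N). \<forall>U. B \<subseteq> U \<and> U \<subseteq> N \<longrightarrow> \<Psi> N v U = \<one>\<^bsub>obj W U\<^esub>}"

text \<open>A preimage over \<open>S\<close> is generated by the faces of \<open>S\<close>, and its
  factorization is pushed forward to \<open>N\<close>.\<close>

lemma image_in_generated:
  assumes gen: "generated_in_degree_le V d" and S: "S \<subseteq> N" "finite N" "d < card S"
    and x: "x \<in> image_in V S N"
  shows "\<exists>h. (\<forall>i\<in>S. h i \<in> image_in V (S - {i}) N) \<and> x = finprod (obj V N) h S"
proof -
  have fS: "finite S" using S finite_subset by blast
  interpret S: comm_group "obj V S" using FI_module_comm_group[OF V fS] .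
  let ?j = "mor V S N (\<lambda>x\<in>S. x)"
  obtain v where v: "v \<in> carrier (obj V S)" and xv: "x = ?j v"
    using x unfolding image_in_def by blast
  obtain h where h: "\<And>i. i \<in> S \<Longrightarrow> h i \<in> image_in V (S - {i}) S" and vh: "v = finprod (obj V S) h S"
    using S.generate_UN_subgroups[OF fS image_in_subgroup[OF V _ fS]
        generated_by_faces[OF V gen fS S(3) v]] by blast
  have hc: "h i \<in> carrier (obj V S)" if "i \<in> S" for i
    by (rule subgroup.mem_carrier[OF image_in_subgroup[OF V _ fS] h[OF that]]) auto
  have "x = finprod (obj V N) (\<lambda>i. ?j (h i)) S"
    unfolding xv vh
    by (rule S.hom_finprod_comm_group[OF FI_module_comm_group[OF V S(2)]
          FI_module_mor_hom[OF V inclusion_FI_hom[OF S(1)] fS S(2)] hc])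
  moreover have "?j (h i) \<in> image_in V (S - {i}) N" if i: "i \<in> S" for i
  proof -
    have sub: "S - {i} \<subseteq> S" "S - {i} \<subseteq> N" "finite (S - {i})" using S fS by auto
    obtain u where u: "u \<in> carrier (obj V (S - {i}))"
      and hu: "h i = mor V (S - {i}) S (\<lambda>x\<in>S - {i}. x) u"
      using h[OF i] unfolding image_in_def by blast
    have "compose (S - {i}) (\<lambda>x\<in>S. x) (\<lambda>x\<in>S - {i}. x) = (\<lambda>x\<in>S - {i}. x)"
      by (auto simp: compose_def restrict_def fun_eq_iff)
    then have "?j (h i) = mor V (S - {i}) N (\<lambda>x\<in>S - {i}. x) u"
      unfolding hu
      using FI_module_mor_compose[OF V inclusion_FI_hom[OF sub(1)] inclusion_FI_hom[OF S(1)]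
          sub(3) fS S(2) u] by simp
    then show ?thesis using u unfolding image_in_def by blast
  qed
  ultimately show ?thesis
    by (intro exI[of _ "\<lambda>i. ?j (h i)"] conjI ballI)
qed

text \<open>Transporting \<open>x\<close> along the injection that renames \<open>c\<close> to \<open>i\<close> changes only components at sets
  containing \<open>c\<close> or \<open>i\<close>, and those above \<open>B\<close> vanish on both sides.\<close>
lemma rename_element:
  assumes N: "finite N" and B: "B \<subseteq> S" and ci: "c \<notin> S" "i \<notin> S" "c \<noteq> i"
    and sub: "insert c (insert i S) \<subseteq> N"
    and x: "x \<in> image_in V (insert c S) N" "x \<in> vanishing_above N (insert c B)"
  shows "\<exists>y\<in>image_in V (insert i S) N. \<exists>r\<in>vanishing_above N B. x = y \<otimes>\<^bsub>obj V N\<^esub> r"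
proof -
  let ?S = "insert c S"
  have S: "?S \<subseteq> N" "finite ?S" using sub finite_subset[OF _ N] by auto
  obtain v where v: "v \<in> carrier (obj V ?S)" and xv: "x = mor V ?S N (\<lambda>x\<in>?S. x) v"
    using x unfolding image_in_def by blast
  define f where "f = (\<lambda>j\<in>?S. if j = c then i else j)"
  have f: "f \<in> FI_hom ?S N" and fS: "f ` ?S = insert i S"
    using ci sub by (auto simp: f_def FI_hom_def inj_on_def)
  define y where "y = mor V ?S N f v"
  have y: "y \<in> image_in V (insert i S) N"
    unfolding y_def by (rule mor_mem_image_in[OF V f _ _ S(2) N v]) (use fS sub in auto)
  interpret N: comm_group "obj V N" using FI_module_comm_group[OF V N] .
  have yc: "y \<in> carrier (obj V N)"
    unfolding y_def by (rule FI_module_mor_closed[OF V f S(2) N v])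
  have xc: "x \<in> carrier (obj V N)"
    using x(2) unfolding vanishing_above_def by blast
  have eq: "\<Psi> N x U = \<Psi> N y U" if U: "B \<subseteq> U" "U \<subseteq> N" for U
  proof -
    have fU: "finite U" using U N finite_subset by blast
    have xU: "\<Psi> N x U = (if U \<subseteq> ?S then \<Psi> ?S v U else \<one>\<^bsub>obj W U\<^esub>)"
      unfolding xv by (rule component_inclusion[OF S(1) N v U(2)])
    have yU: "\<Psi> N y U = (if U \<subseteq> insert i S
       then mor W (f -` U \<inter> ?S) U (restrict f (f -` U \<inter> ?S)) (\<Psi> ?S v (f -` U \<inter> ?S))
       else \<one>\<^bsub>obj W U\<^esub>)"
      unfolding y_def using component_mor[OF f S(2) N v U(2)] fS by simp
    \<comment> \<open>The vanishing assumed of \<open>x\<close> over \<open>N\<close> is read back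
      over \<open>insert c S\<close>, where \<open>v\<close> lives.\<close>
    have vanish: "\<Psi> ?S v U' = \<one>\<^bsub>obj W U'\<^esub>" if "insert c B \<subseteq> U'" "U' \<subseteq> ?S" for U'
    proof -
      have "U' \<subseteq> N" using that S by blast
      then have "\<Psi> N x U' = \<one>\<^bsub>obj W U'\<^esub>"
        using x(2) that(1) unfolding vanishing_above_def by blast
      then show ?thesis
        unfolding xv using component_inclusion[OF S(1) N v \<open>U' \<subseteq> N\<close>] that by simp
    qed
    \<comment> \<open>On subsets of \<open>S\<close> the renaming is the identity. If
      \<open>c \<in> U\<close>, then \<open>y\<close> has no component at \<open>U\<close>, and that
      of \<open>x\<close> vanishes by assumption. If \<open>U\<close> contains \<open>i\<close> but
      not \<open>c\<close>, then \<open>x\<close> has none, and that of \<open>y\<close> is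
      transported from a set above \<open>insert c B\<close>. In the last case neither has
      one.\<close>
    consider "U \<subseteq> S" | "c \<in> U" | "c \<notin> U" "i \<in> U" "U \<subseteq> insert i S"
      | "c \<notin> U" "\<not> U \<subseteq> insert i S" by blast
    then show ?thesis
    proof cases
      case 1
      then have "f -` U \<inter> ?S = U" "restrict f U = (\<lambda>x\<in>U. x)"
        using ci unfolding f_def by (auto simp: restrict_def fun_eq_iff split: if_splits)
      moreover have "\<Psi> ?S v U \<in> carrier (obj W U)"
        using \<Psi>_closed[OF S(2) v] 1 by (auto simp: PiE_iff)
      ultimately show ?thesis
        using 1 xU yU W_mor_id[OF fU] by auto
    next
      case 2
      then have "\<not> U \<subseteq> insert i S" using ci by blast
      then show ?thesis using xU yU vanish[of U] 2 U by simp
    next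
      case 3
      let ?U = "f -` U \<inter> ?S"
      have U': "?U = insert c (U - {i})"
        using 3 ci unfolding f_def by (auto split: if_splits)
      have fU': "finite ?U" using S(2) by blast
      have fb: "restrict f ?U \<in> FB_hom ?U U"
      proof -
        have "f ` ?U = U" using 3(3) unfolding fS[symmetric] by blast
        moreover have "inj_on f ?U"
          using f unfolding FI_hom_def by (blast intro: inj_on_subset)
        ultimately have bij: "bij_betw (restrict f ?U) ?U U"
          unfolding bij_betw_def inj_on_restrict_eq image_restrict_eq by blast
        have "restrict f ?U \<in> ?U \<rightarrow>\<^sub>E U" by auto
        with bij show ?thesis
          unfolding FB_hom_def by (intro CollectI conjI)
      qed
      have "mor W ?U U (restrict f ?U) \<one>\<^bsub>obj W ?U\<^esub> = \<one>\<^bsub>obj W U\<^esub>"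
        by (rule hom_one[OF W_mor_hom[OF fb fU' fU] W_group[OF fU'] W_group[OF fU]])
      moreover have "\<Psi> ?S v ?U = \<one>\<^bsub>obj W ?U\<^esub>"
        using 3 B U ci by (intro vanish) (auto simp: U')
      moreover have "\<not> U \<subseteq> ?S" using 3 ci by blast
      ultimately show ?thesis using xU yU 3 by simp
    next
      case 4
      then have "\<not> U \<subseteq> ?S" by blast
      then show ?thesis using xU yU 4 by simp
    qed
  qed
  define r where "r = inv\<^bsub>obj V N\<^esub> y \<otimes>\<^bsub>obj V N\<^esub> x"
  have "\<Psi> N r U = \<one>\<^bsub>obj W U\<^esub>" if U: "B \<subseteq> U" "U \<subseteq> N" for U
  proof -
    interpret group_hom "obj V N" "obj W U" "\<lambda>v. \<Psi> N v U"
      using component_group_hom[OF N U(2)] .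
    show ?thesis unfolding r_def using xc yc eq[OF U] by simp
  qed
  then have "r \<in> vanishing_above N B"
    unfolding vanishing_above_def using xc yc by (simp add: r_def)
  moreover have "x = y \<otimes>\<^bsub>obj V N\<^esub> r"
    unfolding r_def using xc yc by (simp add: N.m_assoc[symmetric])
  ultimately show ?thesis using y by blast
qed

lemma vanishing_above_subgroup:
  assumes N: "finite N"
  shows "subgroup (vanishing_above N B) (obj V N)"
proof -
  interpret N: comm_group "obj V N" using FI_module_comm_group[OF V N] .
  show ?thesis
  proof (rule N.subgroupI)
    show "vanishing_above N B \<subseteq> carrier (obj V N)"
      unfolding vanishing_above_def by blast
    have "\<Psi> N \<one>\<^bsub>obj V N\<^esub> U = \<one>\<^bsub>obj W U\<^esub>" if "U \<subseteq> N" for U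
      using group_hom.hom_one[OF component_group_hom[OF N that]] .
    then have "\<one>\<^bsub>obj V N\<^esub> \<in> vanishing_above N B"
      by (simp add: vanishing_above_def)
    then show "vanishing_above N B \<noteq> {}" by blast
  next
    fix a assume a: "a \<in> vanishing_above N B"
    have "\<Psi> N (inv\<^bsub>obj V N\<^esub> a) U = \<one>\<^bsub>obj W U\<^esub>" if "B \<subseteq> U" "U \<subseteq> N" for U
    proof -
      interpret group_hom "obj V N" "obj W U" "\<lambda>v. \<Psi> N v U"
        using component_group_hom[OF N that(2)] .
      show ?thesis using a that by (simp add: vanishing_above_def)
    qed
    then show "inv\<^bsub>obj V N\<^esub> a \<in> vanishing_above N B"
      using a by (simp add: vanishing_above_def)
  next
    fix a b assume a: "a \<in> vanishing_above N B" and b: "b \<in> vanishing_above N B"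
    have "\<Psi> N (a \<otimes>\<^bsub>obj V N\<^esub> b) U = \<one>\<^bsub>obj W U\<^esub>" if "B \<subseteq> U" "U \<subseteq> N" for U
    proof -
      interpret group_hom "obj V N" "obj W U" "\<lambda>v. \<Psi> N v U"
        using component_group_hom[OF N that(2)] .
      show ?thesis using a b that by (simp add: vanishing_above_def)
    qed
    then show "a \<otimes>\<^bsub>obj V N\<^esub> b \<in> vanishing_above N B"
      using a b by (simp add: vanishing_above_def)
  qed
qed

text \<open>The bound \<open>top\<close> is an assumption because it comes from the generation
  degree of the free module, not from that of \<open>V\<close>.\<close>

lemma filtered_cube_vanishing:
  assumes N: "finite N" and gen: "generated_in_degree_le V d"
    and top: "\<And>U v. U \<subseteq> N \<Longrightarrow> k < card U \<Longrightarrow> v \<in> carrier (obj V N) \<Longrightarrow> \<Psi> N v U = \<one>\<^bsub>obj W U\<^esub>"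
  shows "filtered_cube (obj V N) N (\<lambda>S. image_in V S N) (vanishing_above N) k d"
proof (intro filtered_cube.intro filtered_cube_axioms.intro)
  show "comm_group (obj V N)" using FI_module_comm_group[OF V N] .
  show "finite N" by fact
  show "subgroup (image_in V S N) (obj V N)" if "S \<subseteq> N" for S
    using image_in_subgroup[OF V that N] .
  show "image_in V S N \<subseteq> image_in V T N" if "S \<subseteq> T" "T \<subseteq> N" for S T
  proof
    fix x assume "x \<in> image_in V S N"
    then obtain v where v: "v \<in> carrier (obj V S)" and x: "x = mor V S N (\<lambda>x\<in>S. x) v"
      unfolding image_in_def by blast
    have SN: "S \<subseteq> N" using that by blast
    have "(\<lambda>x\<in>S. x) ` S \<subseteq> T" using that by auto
    then show "x \<in> image_in V T N"
      unfolding x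
      by (rule mor_mem_image_in[OF V inclusion_FI_hom[OF SN] _ that(2) finite_subset[OF SN N] N v])
  qed
  show "subgroup (vanishing_above N B) (obj V N)" for B
    using vanishing_above_subgroup[OF N] .
  show "vanishing_above N B \<subseteq> vanishing_above N C" if "B \<subseteq> C" for B C
    using that unfolding vanishing_above_def by blast
  show "image_in V S N \<subseteq> vanishing_above N B" if S: "S \<subseteq> N" and i: "i \<in> B" "i \<notin> S" for S B i
  proof
    fix x assume x: "x \<in> image_in V S N"
    then obtain v where v: "v \<in> carrier (obj V S)" and xv: "x = mor V S N (\<lambda>x\<in>S. x) v"
      unfolding image_in_def by blast
    \<comment> \<open>Every \<open>U\<close> above \<open>B\<close> contains \<open>i\<close> and is
      therefore no subset of \<open>S\<close>.\<close>
    have "\<Psi> N x U = \<one>\<^bsub>obj W U\<^esub>" if "B \<subseteq> U" "U \<subseteq> N" for U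
      unfolding xv using component_inclusion[OF S N v that(2)] that i by auto
    moreover have "x \<in> carrier (obj V N)"
      by (rule subgroup.mem_carrier[OF image_in_subgroup[OF V S N] x])
    ultimately show "x \<in> vanishing_above N B" by (simp add: vanishing_above_def)
  qed
  show "vanishing_above N B = carrier (obj V N)" if "B \<subseteq> N" "k < card B" for B
  proof -
    have "k < card U" if "B \<subseteq> U" "U \<subseteq> N" for U
      using \<open>k < card B\<close> card_mono[OF finite_subset[OF that(2) N] that(1)] by simp
    then show ?thesis unfolding vanishing_above_def by (auto intro!: top)
  qed
  show "\<exists>h. (\<forall>i\<in>S. h i \<in> image_in V (S - {i}) N) \<and> x = finprod (obj V N) h S"
    if "S \<subseteq> N" "d < card S" "x \<in> image_in V S N" for S x
    using image_in_generated[OF gen that(1) N that(2,3)] .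
  show "\<exists>y\<in>image_in V (insert i S) N. \<exists>r\<in>vanishing_above N B. x = y \<otimes>\<^bsub>obj V N\<^esub> r"
    if "B \<subseteq> S" "c \<notin> S" "i \<notin> S" "c \<noteq> i" "insert c (insert i S) \<subseteq> N"
      "x \<in> image_in V (insert c S) N" "x \<in> vanishing_above N (insert c B)" for B S c i x
    using rename_element[OF N that] .
qed

end

section \<open>The kernel of a map to a free FI-module\<close>

lemma FI_module_hom_compose:
  assumes \<phi>: "FI_module_hom U V \<phi>" and \<psi>: "FI_module_hom V W \<psi>"
  shows "FI_module_hom U W (\<lambda>S v. \<psi> S (\<phi> S v))"
proof -
  have "(\<lambda>v. \<psi> S (\<phi> S v)) \<in> hom (obj U S) (obj W S)" if "finite S" for S
  proof -
    have "\<phi> S \<in> hom (obj U S) (obj V S)" "\<psi> S \<in> hom (obj V S) (obj W S)"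
      using \<phi> \<psi> that by (auto simp: FI_module_hom_def)
    then have "\<psi> S \<circ> \<phi> S \<in> hom (obj U S) (obj W S)" by (rule hom_compose)
    then show ?thesis by (simp add: comp_def)
  qed
  moreover have "\<phi> S v \<in> carrier (obj V S)" if "finite S" "v \<in> carrier (obj U S)" for S v
    using \<phi> that by (auto simp: FI_module_hom_def intro: hom_in_carrier)
  ultimately show ?thesis
    using \<phi> \<psi> by (simp add: FI_module_hom_def)
qed

theorem corollaryB:
  fixes k d :: nat
    and M :: "'m fin_functor"
    and V :: "'v fin_functor"
    and \<phi> :: "nat set \<Rightarrow> 'v \<Rightarrow> 'm"
  assumes "free_FI_module M"
    and "generated_in_degree_le M k"
    and "FI_module V"
    and "generated_in_degree_le V d"
    and "FI_module_hom V M \<phi>"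
  shows "generated_in_degree_le (FI_kernel V M \<phi>) (k + d + 1)"
  unfolding generated_in_degree_le_iff
proof (intro allI impI)
  note genM = assms(2) and V = assms(3) and genV = assms(4) and \<phi> = assms(5)
  obtain W :: "'m fin_functor" and \<psi> where M: "FI_module M" and W: "FB_module W"
    and \<psi>: "FI_module_hom M (M_free W) \<psi>"
    and iso: "\<And>S. finite S \<Longrightarrow> \<psi> S \<in> iso (obj M S) (obj (M_free W) S)"
    using assms(1) unfolding free_FI_module_def FI_module_isomorphic_def by blast
  let ?\<Psi> = "\<lambda>S v. \<psi> S (\<phi> S v)"
  interpret M: map_to_free M W \<psi> by (rule map_to_free.intro[OF M W \<psi>])
  interpret V: map_to_free V W ?\<Psi>
    by (rule map_to_free.intro[OF V W FI_module_hom_compose[OF \<phi> \<psi>]])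
  fix n assume n: "k + d + 1 < n"
  define N where "N = {1..n}"
  have N: "finite N" "card N = n" unfolding N_def by auto
  have \<phi>_hom: "\<phi> S \<in> hom (obj V S) (obj M S)" if "finite S" for S
    using \<phi> that by (simp add: FI_module_hom_def)
  have \<phi>_group_hom: "group_hom (obj V S) (obj M S) (\<phi> S)" if "finite S" for S
    using \<phi>_hom[OF that] FI_module_comm_group[OF V that] FI_module_comm_group[OF M that]
    by (intro group_hom.intro group_hom_axioms.intro comm_group.axioms(2))
  interpret VN: comm_group "obj V N" using FI_module_comm_group[OF V N(1)] .
  interpret \<phi>: group_hom "obj V N" "obj M N" "\<phi> N" using \<phi>_group_hom[OF N(1)] .
  let ?K = "\<lambda>S. kernel (obj V S) (obj M S) (\<phi> S)"
  have K_carrier: "carrier (obj (FI_kernel V M \<phi>) S) = ?K S" for S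
    by (simp add: FI_kernel_def)
  \<comment> \<open>The family of neutral elements is the image of the unit, and
    \<open>\<psi> S\<close> is injective; so membership in the kernel of \<open>\<phi> S\<close> can
    be tested on components.\<close>
  have \<psi>_one: "\<psi> S w = (\<lambda>U\<in>Pow S. \<one>\<^bsub>obj W U\<^esub>) \<longleftrightarrow> w = \<one>\<^bsub>obj M S\<^esub>"
    if S: "finite S" and w: "w \<in> carrier (obj M S)" for S w
  proof -
    have inj: "inj_on (\<psi> S) (carrier (obj M S))"
      using iso[OF S] by (simp add: iso_def bij_betw_def)
    have M1: "\<one>\<^bsub>obj M S\<^esub> \<in> carrier (obj M S)"
      using group.is_monoid[OF comm_group.axioms(2)[OF FI_module_comm_group[OF M S]]]
      by (rule monoid.one_closed)
    have "\<psi> S \<one>\<^bsub>obj M S\<^esub> U = \<one>\<^bsub>obj W U\<^esub>" if "U \<subseteq> S" for U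
      using group_hom.hom_one[OF M.component_group_hom[OF S that]] .
    moreover have "\<psi> S \<one>\<^bsub>obj M S\<^esub> \<in> extensional (Pow S)"
      using M.\<Psi>_closed[OF S M1] by (simp add: PiE_iff)
    ultimately have "\<psi> S \<one>\<^bsub>obj M S\<^esub> = (\<lambda>U\<in>Pow S. \<one>\<^bsub>obj W U\<^esub>)"
      by (intro extensionalityI[of _ "Pow S"]) auto
    then show ?thesis
      using inj_on_eq_iff[OF inj w M1] by metis
  qed
  have in_K: "v \<in> ?K S" if S: "finite S" and v: "v \<in> carrier (obj V S)"
    and c: "\<And>U. U \<subseteq> S \<Longrightarrow> ?\<Psi> S v U = \<one>\<^bsub>obj W U\<^esub>" for S v
  proof -
    have "?\<Psi> S v \<in> extensional (Pow S)"
      using V.\<Psi>_closed[OF S v] by (simp add: PiE_iff)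
    then have "\<psi> S (\<phi> S v) = (\<lambda>U\<in>Pow S. \<one>\<^bsub>obj W U\<^esub>)"
      using c by (intro extensionalityI[of _ "Pow S"]) auto
    then show ?thesis
      using \<psi>_one[OF S hom_in_carrier[OF \<phi>_hom[OF S] v]] v by (simp add: kernel_def)
  qed
  have mor_K: "mor V S T f v \<in> ?K T"
    if f: "f \<in> FI_hom S T" and ST: "finite S" "finite T" and v: "v \<in> ?K S" for S T f v
  proof -
    have vc: "v \<in> carrier (obj V S)" "\<phi> S v = \<one>\<^bsub>obj M S\<^esub>" using v by (auto simp: kernel_def)
    have "\<phi> T (mor V S T f v) = mor M S T f (\<phi> S v)"
      using \<phi> f ST vc(1) by (simp add: FI_module_hom_def)
    also have "\<dots> = \<one>\<^bsub>obj M T\<^esub>"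
      unfolding vc(2)
      by (rule hom_one[OF FI_module_mor_hom[OF M f ST]])
        (use FI_module_comm_group[OF M] ST comm_group.axioms(2) in auto)
    finally show ?thesis
      using FI_module_mor_closed[OF V f ST vc(1)] by (simp add: kernel_def)
  qed
  let ?gens = "\<Union>{mor V S N f ` ?K S | S f. finite S \<and> card S < card N \<and> f \<in> FI_hom S N}"
  have sub: "?gens \<subseteq> ?K N"
    using mor_K N(1) by blast
  have subV: "?gens \<subseteq> carrier (obj V N)"
    using sub by (auto simp: kernel_def)
  interpret F: filtered_cube "obj V N" N "\<lambda>S. image_in V S N" "V.vanishing_above N" k d
  proof (rule V.filtered_cube_vanishing[OF N(1) genV])
    \<comment> \<open>These are components of the element \<open>\<phi> N v\<close> of
      \<open>M\<close>, and \<open>M\<close> is generated in degree at most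
      \<open>k\<close>.\<close>
    fix U v assume "U \<subseteq> N" "k < card U" "v \<in> carrier (obj V N)"
    then show "?\<Psi> N v U = \<one>\<^bsub>obj W U\<^esub>"
      using M.component_eq_one[OF genM N(1)] hom_in_carrier[OF \<phi>_hom[OF N(1)]] by simp
  qed
  have "x \<in> generate (obj V N) ?gens" if x: "x \<in> ?K N" for x
  proof -
    have xc: "x \<in> carrier (obj V N)" "\<phi> N x = \<one>\<^bsub>obj M N\<^esub>" using x by (auto simp: kernel_def)
    have "x \<in> image_in V N N"
      unfolding image_in_def using FI_module_mor_id[OF V N(1) xc(1)] xc(1) by (metis imageI)
    moreover have "?\<Psi> N x = (\<lambda>U\<in>Pow N. \<one>\<^bsub>obj W U\<^esub>)"
      using \<psi>_one[OF N(1)] xc(2) \<phi>.H.one_closed by simp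
    then have "x \<in> V.vanishing_above N {}"
      unfolding V.vanishing_above_def using xc(1) by simp
    ultimately obtain m where m: "\<And>i. i \<in> N \<Longrightarrow> m i \<in> image_in V (N - {i}) N"
        "\<And>i. i \<in> N \<Longrightarrow> m i \<in> V.vanishing_above N {}" and xm: "x = finprod (obj V N) m N"
      using F.split_kernel_element[of x] n N(2) by auto
    have "m i \<in> ?gens" if i: "i \<in> N" for i
    proof -
      have Ni: "finite (N - {i})" "N - {i} \<subseteq> N" "card (N - {i}) < card N"
        using N i card_Diff1_less[OF N(1) i] by auto
      obtain v where v: "v \<in> carrier (obj V (N - {i}))"
        and mv: "m i = mor V (N - {i}) N (\<lambda>x\<in>N - {i}. x) v"
        using m(1)[OF i] unfolding image_in_def by blast
      \<comment> \<open>The preimage \<open>v\<close> of the kernel element \<open>m i\<close> is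
        itself in the kernel, because the inclusion of \<open>N - {i}\<close> keeps the components
        at subsets of \<open>N - {i}\<close>.\<close>
      have "?\<Psi> (N - {i}) v U = \<one>\<^bsub>obj W U\<^esub>" if U: "U \<subseteq> N - {i}" for U
      proof -
        have UN: "U \<subseteq> N" using U by blast
        then have "?\<Psi> N (m i) U = \<one>\<^bsub>obj W U\<^esub>"
          using m(2)[OF i] unfolding V.vanishing_above_def by blast
        then show ?thesis
          unfolding mv using V.component_inclusion[OF Ni(2) N(1) v UN] U by simp
      qed
      then have "v \<in> ?K (N - {i})" by (rule in_K[OF Ni(1) v])
      then have "m i \<in> mor V (N - {i}) N (\<lambda>x\<in>N - {i}. x) ` ?K (N - {i})"
        unfolding mv by (rule imageI)
      then show ?thesis
        using Ni inclusion_FI_hom[OF Ni(2)] by blast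
    qed
    then show ?thesis
      unfolding xm
      by (intro VN.finprod_in_subgroup[OF VN.generate_is_subgroup[OF subV]] generate.incl)
  qed
  moreover have "generate (obj V N) ?gens \<subseteq> ?K N"
    by (rule VN.generate_subgroup_incl[OF sub \<phi>.subgroup_kernel])
  ultimately have gen: "generate (obj V N) ?gens = ?K N" by blast
  let ?G = "(obj V N)\<lparr>carrier := ?K N\<rparr>"
  interpret K: comm_group ?G
  proof (rule group.group_comm_groupI)
    show "group ?G"
      using subgroup.subgroup_is_group[OF \<phi>.subgroup_kernel VN.is_group] .
    show "x \<otimes>\<^bsub>?G\<^esub> y = y \<otimes>\<^bsub>?G\<^esub> x" if "x \<in> carrier ?G" "y \<in> carrier ?G" for x y
      using that VN.m_comm by (simp add: kernel_def)
  qed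
  \<comment> \<open>\<open>H0\<close> of the kernel takes the span inside the kernel rather than
    inside the group of \<open>V\<close> at \<open>N\<close>; the two spans agree.\<close>
  have "generate ?G ?gens = carrier ?G"
    using VN.generate_consistent[OF sub \<phi>.subgroup_kernel] gen by simp
  moreover have "?gens \<subseteq> carrier ?G" using sub by simp
  ultimately have "trivial_group (?G Mod generate ?G ?gens)"
    using K.trivial_quotient_iff by blast
  then show "trivial_group (H0 (FI_kernel V M \<phi>) {1..n})"
    unfolding H0_def N_def[symmetric] K_carrier by (simp add: FI_kernel_def)
qed

end
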